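(* (Relative completeness of CPRHL.) Suppose the language of assertions is WPR-expressive. Then for every partial reverse Hoare triple $\{P\}\,C\,\{Q\}$ the following are equivalent: (1) $\{P\}\,C\,\{Q\}$ is valid; (2) $\{P\}\,C\,\{Q\}$ is provable in PRHL; (3) $\{P\}\,C\,\{Q\}$ is provable in CPRHL.
   Context: States $\sigma:\mathrm{Var}\to\mathbb{N}$; expressions $E ::= x\mid n\mid f(E,\dots,E)$; Boolean conditions $B ::= Q(E,\dots,E)\mid E=E\mid E\le E\mid\neg B\mid B\wedge B\mid B\vee B$; programs $C ::= \varepsilon\mid C'$, $C' ::= x:=E\mid C';C'\mid\mathtt{while}\ B\ \mathtt{do}\ C\mid C\ \mathtt{or}\ C$ ($\varepsilon$ the empty program; $C_0;C_1$ denotes $C_i$ when $C_{1-i}=\varepsilon$); assertions are first-order formulas over Boolean conditions interpreted over $\mathbb{N}$; $P\models Q$ is semantic entailment; $P[x:=E]$ is substitution. Small-step semantics: $\langle x:=E,\sigma\rangle\to\langle\varepsilon,\sigma[x\mapsto[\![E]\!]\sigma]\rangle$; $\langle\mathtt{while}\ B\ \mathtt{do}\ C,\sigma\rangle\to\langle C;\mathtt{while}\ B\ \mathtt{do}\ C,\sigma\rangle$ if $B$ holds in $\sigma$, else $\to\langle\varepsilon,\sigma\rangle$; $\langle C_0;C_1,\sigma\rangle\to\langle C_0';C_1,\sigma'\rangle$ if $\langle C_0,\sigma\rangle\to\langle C_0',\sigma'\rangle$; $\langle C_0\ \mathtt{or}\ C_1,\sigma\rangle\to\langle C_i,\sigma\rangle$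 ($i=0,1$); $\to^{*}$ the reflexive-transitive closure. Validity: $\{P\}C\{Q\}$ is valid if for all $\sigma'\models Q$ and all $\sigma$ with $\langle C,\sigma\rangle\to^{*}\langle\varepsilon,\sigma'\rangle$, $\sigma\models P$. WPR-expressive: for every $Q$ and $C$ there is an assertion $P$ with $\sigma\models P$ iff $\exists\sigma'(\langle C,\sigma\rangle\to^{*}\langle\varepsilon,\sigma'\rangle\wedge\sigma'\models Q)$. PRHL: finite derivation trees with leaves Axiom or Assign, rules (Axiom) $\{Q\}\varepsilon\{Q\}$; (Assign) $\{Q[x:=E]\}x:=E\{Q\}$; (Seq) from $\{P\}C_0\{R\},\{R\}C_1\{Q\}$ infer $\{P\}C_0;C_1\{Q\}$; (Cons) from $\{P\}C\{Q\}$ infer $\{P'\}C\{Q'\}$ if $P\models P'$, $Q'\models Q$; (Or) from $\{P\}C_0\{Q\},\{P\}C_1\{Q\}$ infer $\{P\}C_0\ \mathtt{or}\ C_1\{Q\}$; (While) from $\{B\to P\}C\{P\}$ infer $\{P\}\mathtt{while}\ B\ \mathtt{do}\ C\{\neg B\to P\}$. CPRHL rules: (Axiom) $\{Q\}\varepsilon\{Q\}$; (Cons) from $\{P'\}C\{Q'\}$ infer $\{P\}C\{Q\}$ if $P'\models P$, $Q\models Q'$; (Assign) from $\{P\}C\{Q\}$ infer $\{P[x:=E]\}x:=E;C\{Q\}$; (Or) from $\{P\}C_0;C\{Q\},\{P\}C_1;C\{Q\}$ infer $\{P\}(C_0\ \mathtt{or}\ C_1);C\{Q\}$; (While) from $\{\neg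 B\to P\}C'\{Q\}$ and $\{B\to P\}C;\mathtt{while}\ B\ \mathtt{do}\ C;C'\{Q\}$ infer $\{P\}\mathtt{while}\ B\ \mathtt{do}\ C;C'\{Q\}$. A CPRHL-pre-proof is a finite derivation tree from these rules together with a map sending each open leaf (leaf not an instance of Axiom) to a companion (inner node with the same triple); it is a CPRHL-proof if along every infinite path (following back-links) rules other than Cons are applied infinitely often. *)

theory Defs
  imports Main "HOL-Library.Infinite_Typeclass" "HOL-Library.Infinite_Set"
begin

section \<open>Language\<close>

(* The signature is arbitrary: function and predicate symbols with fixed arities, together with
   their interpretation over the natural numbers. Interpretations are only ever relevant on
   argument lists of the right length, because of the well-formedness predicates below. *)

record ('f, 'q) signature =
  fun_arity  :: "'f \<Rightarrow> nat"
  rel_arity  :: "'q \<Rightarrow> nat"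
  fun_interp :: "'f \<Rightarrow> nat list \<Rightarrow> nat"
  rel_interp :: "'q \<Rightarrow> nat list \<Rightarrow> bool"

type_synonym 'v state = "'v \<Rightarrow> nat"

datatype ('v, 'f) exp =
    Var 'v
  | Num nat
  | App 'f "('v, 'f) exp list"

datatype ('v, 'f, 'q) bexp =
    BRel 'q "('v, 'f) exp list"
  | BEq "('v, 'f) exp" "('v, 'f) exp"
  | BLe "('v, 'f) exp" "('v, 'f) exp"
  | BNot "('v, 'f, 'q) bexp"
  | BAnd "('v, 'f, 'q) bexp" "('v, 'f, 'q) bexp"
  | BOr "('v, 'f, 'q) bexp" "('v, 'f, 'q) bexp"

(* Programs are finite sequences of the non-sequential commands: the empty list is the empty
   program and sequential composition is @. This is the program syntax taken modulo the
   convention that composing with the empty program does nothing, and modulo associativity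
   of sequential composition. *)

datatype ('v, 'f, 'q) cmd =
    Asg 'v "('v, 'f) exp"
  | While "('v, 'f, 'q) bexp" "('v, 'f, 'q) cmd list"
  | Choice "('v, 'f, 'q) cmd list" "('v, 'f, 'q) cmd list"

type_synonym ('v, 'f, 'q) prog = "('v, 'f, 'q) cmd list"

datatype ('v, 'f, 'q) assn =
    Cond "('v, 'f, 'q) bexp"
  | Neg "('v, 'f, 'q) assn"
  | Conj "('v, 'f, 'q) assn" "('v, 'f, 'q) assn"
  | Disj "('v, 'f, 'q) assn" "('v, 'f, 'q) assn"
  | Imp "('v, 'f, 'q) assn" "('v, 'f, 'q) assn"
  | All 'v "('v, 'f, 'q) assn"
  | Ex 'v "('v, 'f, 'q) assn"

type_synonym ('v, 'f, 'q) triple =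
  "('v, 'f, 'q) assn \<times> ('v, 'f, 'q) prog \<times> ('v, 'f, 'q) assn"


subsection \<open>Well-formedness: every symbol is applied to as many arguments as its arity says\<close>

fun wf_exp :: "('f, 'q) signature \<Rightarrow> ('v, 'f) exp \<Rightarrow> bool" where
  "wf_exp S (Var x) = True"
| "wf_exp S (Num n) = True"
| "wf_exp S (App f Es) = (length Es = fun_arity S f \<and> (\<forall>E\<in>set Es. wf_exp S E))"

fun wf_bexp :: "('f, 'q) signature \<Rightarrow> ('v, 'f, 'q) bexp \<Rightarrow> bool" where
  "wf_bexp S (BRel q Es) = (length Es = rel_arity S q \<and> (\<forall>E\<in>set Es. wf_exp S E))"
| "wf_bexp S (BEq E E') = (wf_exp S E \<and> wf_exp S E')"
| "wf_bexp S (BLe E E') = (wf_exp S E \<and> wf_exp S E')"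
| "wf_bexp S (BNot B) = wf_bexp S B"
| "wf_bexp S (BAnd B B') = (wf_bexp S B \<and> wf_bexp S B')"
| "wf_bexp S (BOr B B') = (wf_bexp S B \<and> wf_bexp S B')"

fun wf_cmd :: "('f, 'q) signature \<Rightarrow> ('v, 'f, 'q) cmd \<Rightarrow> bool" where
  "wf_cmd S (Asg x E) = wf_exp S E"
| "wf_cmd S (While B C) = (wf_bexp S B \<and> (\<forall>c\<in>set C. wf_cmd S c))"
| "wf_cmd S (Choice C C') = ((\<forall>c\<in>set C. wf_cmd S c) \<and> (\<forall>c\<in>set C'. wf_cmd S c))"

definition wf_prog :: "('f, 'q) signature \<Rightarrow> ('v, 'f, 'q) prog \<Rightarrow> bool" where
  "wf_prog S C \<longleftrightarrow> (\<forall>c\<in>set C. wf_cmd S c)"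

fun wf_assn :: "('f, 'q) signature \<Rightarrow> ('v, 'f, 'q) assn \<Rightarrow> bool" where
  "wf_assn S (Cond B) = wf_bexp S B"
| "wf_assn S (Neg P) = wf_assn S P"
| "wf_assn S (Conj P Q) = (wf_assn S P \<and> wf_assn S Q)"
| "wf_assn S (Disj P Q) = (wf_assn S P \<and> wf_assn S Q)"
| "wf_assn S (Imp P Q) = (wf_assn S P \<and> wf_assn S Q)"
| "wf_assn S (All x P) = wf_assn S P"
| "wf_assn S (Ex x P) = wf_assn S P"

fun wf_triple :: "('f, 'q) signature \<Rightarrow> ('v, 'f, 'q) triple \<Rightarrow> bool" where
  "wf_triple S (P, C, Q) = (wf_assn S P \<and> wf_prog S C \<and> wf_assn S Q)"


subsection \<open>Evaluation and entailment\<close>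

fun eval :: "('f, 'q) signature \<Rightarrow> 'v state \<Rightarrow> ('v, 'f) exp \<Rightarrow> nat" where
  "eval S \<sigma> (Var x) = \<sigma> x"
| "eval S \<sigma> (Num n) = n"
| "eval S \<sigma> (App f Es) = fun_interp S f (map (eval S \<sigma>) Es)"

fun holds :: "('f, 'q) signature \<Rightarrow> 'v state \<Rightarrow> ('v, 'f, 'q) bexp \<Rightarrow> bool" where
  "holds S \<sigma> (BRel q Es) = rel_interp S q (map (eval S \<sigma>) Es)"
| "holds S \<sigma> (BEq E E') = (eval S \<sigma> E = eval S \<sigma> E')"
| "holds S \<sigma> (BLe E E') = (eval S \<sigma> E \<le> eval S \<sigma> E')"
| "holds S \<sigma> (BNot B) = (\<not> holds S \<sigma> B)"
| "holds S \<sigma> (BAnd B B') = (holds S \<sigma> B \<and> holds S \<sigma> B')"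
| "holds S \<sigma> (BOr B B') = (holds S \<sigma> B \<or> holds S \<sigma> B')"

fun sat :: "('f, 'q) signature \<Rightarrow> 'v state \<Rightarrow> ('v, 'f, 'q) assn \<Rightarrow> bool" where
  "sat S \<sigma> (Cond B) = holds S \<sigma> B"
| "sat S \<sigma> (Neg P) = (\<not> sat S \<sigma> P)"
| "sat S \<sigma> (Conj P Q) = (sat S \<sigma> P \<and> sat S \<sigma> Q)"
| "sat S \<sigma> (Disj P Q) = (sat S \<sigma> P \<or> sat S \<sigma> Q)"
| "sat S \<sigma> (Imp P Q) = (sat S \<sigma> P \<longrightarrow> sat S \<sigma> Q)"
| "sat S \<sigma> (All x P) = (\<forall>n. sat S (\<sigma>(x := n)) P)"
| "sat S \<sigma> (Ex x P) = (\<exists>n. sat S (\<sigma>(x := n)) P)"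

definition entails :: "('f, 'q) signature \<Rightarrow> ('v, 'f, 'q) assn \<Rightarrow> ('v, 'f, 'q) assn \<Rightarrow> bool" where
  "entails S P Q \<longleftrightarrow> (\<forall>\<sigma>. sat S \<sigma> P \<longrightarrow> sat S \<sigma> Q)"


subsection \<open>Substitution\<close>

fun exp_vars :: "('v, 'f) exp \<Rightarrow> 'v set" where
  "exp_vars (Var x) = {x}"
| "exp_vars (Num n) = {}"
| "exp_vars (App f Es) = (\<Union>E\<in>set Es. exp_vars E)"

fun bexp_vars :: "('v, 'f, 'q) bexp \<Rightarrow> 'v set" where
  "bexp_vars (BRel q Es) = (\<Union>E\<in>set Es. exp_vars E)"
| "bexp_vars (BEq E E') = exp_vars E \<union> exp_vars E'"
| "bexp_vars (BLe E E') = exp_vars E \<union> exp_vars E'"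
| "bexp_vars (BNot B) = bexp_vars B"
| "bexp_vars (BAnd B B') = bexp_vars B \<union> bexp_vars B'"
| "bexp_vars (BOr B B') = bexp_vars B \<union> bexp_vars B'"

fun free_vars :: "('v, 'f, 'q) assn \<Rightarrow> 'v set" where
  "free_vars (Cond B) = bexp_vars B"
| "free_vars (Neg P) = free_vars P"
| "free_vars (Conj P Q) = free_vars P \<union> free_vars Q"
| "free_vars (Disj P Q) = free_vars P \<union> free_vars Q"
| "free_vars (Imp P Q) = free_vars P \<union> free_vars Q"
| "free_vars (All x P) = free_vars P - {x}"
| "free_vars (Ex x P) = free_vars P - {x}"

fun exp_subst :: "('v \<Rightarrow> ('v, 'f) exp) \<Rightarrow> ('v, 'f) exp \<Rightarrow> ('v, 'f) exp" where
  "exp_subst \<theta> (Var x) = \<theta> x"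
| "exp_subst \<theta> (Num n) = Num n"
| "exp_subst \<theta> (App f Es) = App f (map (exp_subst \<theta>) Es)"

fun bexp_subst :: "('v \<Rightarrow> ('v, 'f) exp) \<Rightarrow> ('v, 'f, 'q) bexp \<Rightarrow> ('v, 'f, 'q) bexp" where
  "bexp_subst \<theta> (BRel q Es) = BRel q (map (exp_subst \<theta>) Es)"
| "bexp_subst \<theta> (BEq E E') = BEq (exp_subst \<theta> E) (exp_subst \<theta> E')"
| "bexp_subst \<theta> (BLe E E') = BLe (exp_subst \<theta> E) (exp_subst \<theta> E')"
| "bexp_subst \<theta> (BNot B) = BNot (bexp_subst \<theta> B)"
| "bexp_subst \<theta> (BAnd B B') = BAnd (bexp_subst \<theta> B) (bexp_subst \<theta> B')"
| "bexp_subst \<theta> (BOr B B') = BOr (bexp_subst \<theta> B) (bexp_subst \<theta> B')"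

(* The name used for the bound variable x of a quantifier with body P after substituting:
   x itself unless this would capture a variable. *)

definition bound_name ::
    "('v::infinite \<Rightarrow> ('v, 'f) exp) \<Rightarrow> 'v \<Rightarrow> ('v, 'f, 'q) assn \<Rightarrow> 'v" where
  "bound_name \<theta> x P =
     (let V = (\<Union>y\<in>free_vars P - {x}. exp_vars (\<theta> y))
      in if x \<notin> V then x else (SOME z. z \<notin> V))"

fun assn_subst ::
    "('v::infinite \<Rightarrow> ('v, 'f) exp) \<Rightarrow> ('v, 'f, 'q) assn \<Rightarrow> ('v, 'f, 'q) assn" where
  "assn_subst \<theta> (Cond B) = Cond (bexp_subst \<theta> B)"
| "assn_subst \<theta> (Neg P) = Neg (assn_subst \<theta> P)"
| "assn_subst \<theta> (Conj P Q) = Conj (assn_subst \<theta> P) (assn_subst \<theta> Q)"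
| "assn_subst \<theta> (Disj P Q) = Disj (assn_subst \<theta> P) (assn_subst \<theta> Q)"
| "assn_subst \<theta> (Imp P Q) = Imp (assn_subst \<theta> P) (assn_subst \<theta> Q)"
| "assn_subst \<theta> (All x P) =
     (let z = bound_name \<theta> x P in All z (assn_subst (\<theta>(x := Var z)) P))"
| "assn_subst \<theta> (Ex x P) =
     (let z = bound_name \<theta> x P in Ex z (assn_subst (\<theta>(x := Var z)) P))"

definition subst ::
    "('v::infinite, 'f, 'q) assn \<Rightarrow> 'v \<Rightarrow> ('v, 'f) exp \<Rightarrow> ('v, 'f, 'q) assn" where
  "subst P x E = assn_subst (Var(x := E)) P"


section \<open>Semantics and validity\<close>

inductive step ::
    "('f, 'q) signature \<Rightarrow> ('v, 'f, 'q) prog \<times> 'v state \<Rightarrow> ('v, 'f, 'q) prog \<times> 'v state \<Rightarrow> bool"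
  for S where
  step_assign: "step S ([Asg x E], \<sigma>) ([], \<sigma>(x := eval S \<sigma> E))"
| step_while_true: "holds S \<sigma> B \<Longrightarrow> step S ([While B C], \<sigma>) (C @ [While B C], \<sigma>)"
| step_while_false: "\<not> holds S \<sigma> B \<Longrightarrow> step S ([While B C], \<sigma>) ([], \<sigma>)"
| step_seq: "step S (C0, \<sigma>) (C0', \<sigma>') \<Longrightarrow> step S (C0 @ C1, \<sigma>) (C0' @ C1, \<sigma>')"
| step_choice0: "step S ([Choice C0 C1], \<sigma>) (C0, \<sigma>)"
| step_choice1: "step S ([Choice C0 C1], \<sigma>) (C1, \<sigma>)"

definition terminates_in ::
    "('f, 'q) signature \<Rightarrow> ('v, 'f, 'q) prog \<Rightarrow> 'v state \<Rightarrow> 'v state \<Rightarrow> bool" where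
  "terminates_in S C \<sigma> \<sigma>' \<longleftrightarrow> (step S)\<^sup>*\<^sup>* (C, \<sigma>) ([], \<sigma>')"

fun valid :: "('f, 'q) signature \<Rightarrow> ('v, 'f, 'q) triple \<Rightarrow> bool" where
  "valid S (P, C, Q) \<longleftrightarrow>
     (\<forall>\<sigma>'. sat S \<sigma>' Q \<longrightarrow> (\<forall>\<sigma>. terminates_in S C \<sigma> \<sigma>' \<longrightarrow> sat S \<sigma> P))"

(* The type argument only records over which set of variables assertions and programs are
   built; it is not determined by the signature. *)

definition wpr_expressive :: "'v itself \<Rightarrow> ('f, 'q) signature \<Rightarrow> bool" where
  "wpr_expressive _ S \<longleftrightarrow>
     (\<forall>(Q :: ('v, 'f, 'q) assn) (C :: ('v, 'f, 'q) prog). wf_assn S Q \<longrightarrow> wf_prog S C \<longrightarrow>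
        (\<exists>P :: ('v, 'f, 'q) assn. wf_assn S P \<and>
           (\<forall>\<sigma>. sat S \<sigma> P \<longleftrightarrow> (\<exists>\<sigma>'. terminates_in S C \<sigma> \<sigma>' \<and> sat S \<sigma>' Q))))"


section \<open>The proof system PRHL\<close>

inductive prhl :: "('f, 'q) signature \<Rightarrow> ('v::infinite, 'f, 'q) triple \<Rightarrow> bool" for S where
  prhl_axiom: "wf_assn S Q \<Longrightarrow> prhl S (Q, [], Q)"
| prhl_assign: "wf_assn S Q \<Longrightarrow> wf_exp S E \<Longrightarrow> prhl S (subst Q x E, [Asg x E], Q)"
| prhl_seq: "prhl S (P, C0, R) \<Longrightarrow> prhl S (R, C1, Q) \<Longrightarrow> prhl S (P, C0 @ C1, Q)"
| prhl_cons: "prhl S (P, C, Q) \<Longrightarrow> wf_assn S P' \<Longrightarrow> wf_assn S Q' \<Longrightarrow>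
    entails S P P' \<Longrightarrow> entails S Q' Q \<Longrightarrow> prhl S (P', C, Q')"
| prhl_or: "prhl S (P, C0, Q) \<Longrightarrow> prhl S (P, C1, Q) \<Longrightarrow> prhl S (P, [Choice C0 C1], Q)"
| prhl_while: "prhl S (Imp (Cond B) P, C, P) \<Longrightarrow>
    prhl S (P, [While B C], Imp (Cond (BNot B)) P)"


section \<open>The cyclic proof system CPRHL\<close>

datatype rule = ConsR | AssignR | OrR | WhileR

(* cprhl_rule S r ts t: the triple t follows from the list ts of premises by one application
   of r. Axiom is not listed, since its instances are leaves. *)

inductive cprhl_rule ::
    "('f, 'q) signature \<Rightarrow> rule \<Rightarrow> ('v::infinite, 'f, 'q) triple list \<Rightarrow> ('v, 'f, 'q) triple \<Rightarrow> bool"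
  for S where
  "entails S P' P \<Longrightarrow> entails S Q Q' \<Longrightarrow> cprhl_rule S ConsR [(P', C, Q')] (P, C, Q)"
| "cprhl_rule S AssignR [(P, C, Q)] (subst P x E, [Asg x E] @ C, Q)"
| "cprhl_rule S OrR [(P, C0 @ C, Q), (P, C1 @ C, Q)] (P, [Choice C0 C1] @ C, Q)"
| "cprhl_rule S WhileR
     [(Imp (Cond (BNot B)) P, C', Q), (Imp (Cond B) P, C @ [While B C] @ C', Q)]
     (P, [While B C] @ C', Q)"

datatype ('v, 'f, 'q) dtree =
    Leaf "('v, 'f, 'q) triple"
  | Inner rule "('v, 'f, 'q) triple" "('v, 'f, 'q) dtree list"

fun root :: "('v, 'f, 'q) dtree \<Rightarrow> ('v, 'f, 'q) triple" where
  "root (Leaf t) = t"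
| "root (Inner r t Ds) = t"

fun derivation :: "('f, 'q) signature \<Rightarrow> ('v::infinite, 'f, 'q) dtree \<Rightarrow> bool" where
  "derivation S (Leaf t) = wf_triple S t"
| "derivation S (Inner r t Ds) =
     (wf_triple S t \<and> cprhl_rule S r (map root Ds) t \<and> (\<forall>D\<in>set Ds. derivation S D))"

(* Nodes are addressed by the sequence of child indices leading to them from the root. *)

type_synonym pos = "nat list"

fun subtree :: "('v, 'f, 'q) dtree \<Rightarrow> pos \<Rightarrow> ('v, 'f, 'q) dtree option" where
  "subtree D [] = Some D"
| "subtree (Leaf t) (i # p) = None"
| "subtree (Inner r t Ds) (i # p) = (if i < length Ds then subtree (Ds ! i) p else None)"

definition axiom_instance :: "('v, 'f, 'q) triple \<Rightarrow> bool" where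
  "axiom_instance t \<longleftrightarrow> (\<exists>Q. t = (Q, [], Q))"

definition open_leaf :: "('v, 'f, 'q) dtree \<Rightarrow> pos \<Rightarrow> bool" where
  "open_leaf D p \<longleftrightarrow> (\<exists>t. subtree D p = Some (Leaf t) \<and> \<not> axiom_instance t)"

definition companion :: "('v, 'f, 'q) dtree \<Rightarrow> pos \<Rightarrow> pos \<Rightarrow> bool" where
  "companion D p q \<longleftrightarrow>
     (\<exists>t r Ds. subtree D p = Some (Leaf t) \<and> subtree D q = Some (Inner r t Ds))"

(* The back-link map b is only relevant on the open leaves. *)

definition pre_proof ::
    "('f, 'q) signature \<Rightarrow> ('v::infinite, 'f, 'q) dtree \<Rightarrow> (pos \<Rightarrow> pos) \<Rightarrow> bool" where
  "pre_proof S D b \<longleftrightarrow> derivation S D \<and> (\<forall>p. open_leaf D p \<longrightarrow> companion D p (b p))"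

definition edge :: "('v, 'f, 'q) dtree \<Rightarrow> (pos \<Rightarrow> pos) \<Rightarrow> pos \<Rightarrow> pos \<Rightarrow> bool" where
  "edge D b p q \<longleftrightarrow>
     (\<exists>r t Ds i. subtree D p = Some (Inner r t Ds) \<and> i < length Ds \<and> q = p @ [i]) \<or>
     (open_leaf D p \<and> q = b p)"

definition infinite_path :: "('v, 'f, 'q) dtree \<Rightarrow> (pos \<Rightarrow> pos) \<Rightarrow> (nat \<Rightarrow> pos) \<Rightarrow> bool" where
  "infinite_path D b \<pi> \<longleftrightarrow> (\<forall>n. edge D b (\<pi> n) (\<pi> (Suc n)))"

definition cprhl_proof ::
    "('f, 'q) signature \<Rightarrow> ('v::infinite, 'f, 'q) dtree \<Rightarrow> (pos \<Rightarrow> pos) \<Rightarrow> bool" where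
  "cprhl_proof S D b \<longleftrightarrow> pre_proof S D b \<and>
     (\<forall>\<pi>. infinite_path D b \<pi> \<longrightarrow>
        (\<exists>\<^sub>\<infinity>n. \<exists>r t Ds. subtree D (\<pi> n) = Some (Inner r t Ds) \<and> r \<noteq> ConsR))"

definition cprhl :: "('f, 'q) signature \<Rightarrow> ('v::infinite, 'f, 'q) triple \<Rightarrow> bool" where
  "cprhl S t \<longleftrightarrow> (\<exists>D b. cprhl_proof S D b \<and> root D = t)"

end

theory Submission
  imports Defs
begin

text \<open>
  Both completeness proofs use the assertions \<open>weakest_pre S Q C\<close> supplied by expressiveness; for a
  loop this assertion is the loop invariant. In CPRHL a derivation for \<open>C'\<close> is extended backwards to
  one for \<open>C @ C'\<close> by recursion on \<open>C\<close>, every triple carrying its weakest precondition. Unrolling a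
  loop then leads back to literally the same triple, which is closed by a back-link.
  CPRHL is sound because a run of \<open>n\<close> steps refuting the conclusion of a rule yields a run refuting
  some premise, with at most \<open>n\<close> steps, and fewer than \<open>n\<close> for rules other than Cons: an invalid root
  would give an infinite path violating the global condition.
\<close>

section \<open>Substitution\<close>

lemma eval_cong: "(\<And>y. y \<in> exp_vars E \<Longrightarrow> \<sigma> y = \<tau> y) \<Longrightarrow> eval S \<sigma> E = eval S \<tau> E"
proof (induction E)
  case (App f Es)
  have "eval S \<sigma> E = eval S \<tau> E" if "E \<in> set Es" for E
    by (rule App.IH[OF that]) (use App.prems that in auto)
  then have "map (eval S \<sigma>) Es = map (eval S \<tau>) Es"
    by simp
  then show ?case
    by (metis eval.simps(3))
qed auto

lemma holds_cong: "(\<And>y. y \<in> bexp_vars B \<Longrightarrow> \<sigma> y = \<tau> y) \<Longrightarrow> holds S \<sigma> B = holds S \<tau> B"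
proof (induction B)
  case (BRel q Es)
  then have "map (eval S \<sigma>) Es = map (eval S \<tau>) Es"
    by (auto intro: eval_cong)
  then show ?case
    by (metis holds.simps(1))
next
  case (BEq E E')
  then have "eval S \<sigma> E = eval S \<tau> E" "eval S \<sigma> E' = eval S \<tau> E'"
    by (auto intro: eval_cong)
  then show ?case
    by simp
next
  case (BLe E E')
  then have "eval S \<sigma> E = eval S \<tau> E" "eval S \<sigma> E' = eval S \<tau> E'"
    by (auto intro: eval_cong)
  then show ?case
    by simp
qed auto

lemma sat_cong: "(\<And>y. y \<in> free_vars P \<Longrightarrow> \<sigma> y = \<tau> y) \<Longrightarrow> sat S \<sigma> P = sat S \<tau> P"
proof (induction P arbitrary: \<sigma> \<tau>)
  case (Cond B)
  have "holds S \<sigma> B = holds S \<tau> B"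
    by (rule holds_cong) (use Cond in auto)
  then show ?case
    by simp
next
  case (Neg P)
  from Neg.IH[of \<sigma> \<tau>] Neg.prems show ?case
    by simp
next
  case (Conj P Q)
  from Conj.IH[of \<sigma> \<tau>] Conj.prems show ?case
    by simp
next
  case (Disj P Q)
  from Disj.IH[of \<sigma> \<tau>] Disj.prems show ?case
    by simp
next
  case (Imp P Q)
  from Imp.IH[of \<sigma> \<tau>] Imp.prems show ?case
    by simp
next
  case (All x P)
  have "sat S (\<sigma>(x := n)) P = sat S (\<tau>(x := n)) P" for n
    by (rule All.IH) (use All.prems in auto)
  then show ?case
    by simp
next
  case (Ex x P)
  have "sat S (\<sigma>(x := n)) P = sat S (\<tau>(x := n)) P" for n
    by (rule Ex.IH) (use Ex.prems in auto)
  then show ?case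
    by simp
qed

section \<open>The substitution lemma, with renaming of bound variables\<close>

lemma eval_subst: "eval S \<sigma> (exp_subst \<theta> E) = eval S (\<lambda>x. eval S \<sigma> (\<theta> x)) E"
  by (induction E) (auto simp: o_def intro!: arg_cong[where f = "fun_interp S _"])

lemma holds_subst: "holds S \<sigma> (bexp_subst \<theta> B) = holds S (\<lambda>x. eval S \<sigma> (\<theta> x)) B"
  by (induction B) (auto simp: eval_subst o_def)

lemma finite_exp_vars: "finite (exp_vars E)"
  by (induction E) auto

lemma finite_bexp_vars: "finite (bexp_vars B)"
  by (induction B) (auto simp: finite_exp_vars)

lemma finite_free_vars: "finite (free_vars P)"
  by (induction P) (auto simp: finite_bexp_vars)

text \<open>The set \<open>V\<close> of names to avoid is finite and the type of variables is
  infinite, so a fresh name exists; in either branch of the definition the name chosen lies outside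
  \<open>V\<close>.\<close>

lemma bound_name_fresh:
  assumes "y \<in> free_vars P" "y \<noteq> x"
  shows "bound_name \<theta> x P \<notin> exp_vars (\<theta> y)"
proof -
  define V where "V = (\<Union>y\<in>free_vars P - {x}. exp_vars (\<theta> y))"
  have "finite V"
    by (simp add: V_def finite_free_vars finite_exp_vars)
  then have "(SOME z. z \<notin> V) \<notin> V"
    by (intro someI_ex[of "\<lambda>z. z \<notin> V"] ex_new_if_finite infinite_UNIV)
  then have "bound_name \<theta> x P \<notin> V"
    by (auto simp: bound_name_def V_def[symmetric] Let_def)
  then show ?thesis
    using assms by (auto simp: V_def)
qed

text \<open>The quantifier case of the substitution lemma. At \<open>x\<close> both states give
  \<open>n\<close>; at any other free variable \<open>y\<close> the new name does not occur in
  \<open>\<theta> y\<close>, so updating it changes nothing.\<close>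

lemma sat_rename_bound:
  "sat S (\<lambda>y. eval S (\<sigma>(bound_name \<theta> x P := n)) ((\<theta>(x := Var (bound_name \<theta> x P))) y)) P \<longleftrightarrow>
   sat S ((\<lambda>y. eval S \<sigma> (\<theta> y))(x := n)) P"
proof (rule sat_cong)
  fix y
  assume y: "y \<in> free_vars P"
  show "eval S (\<sigma>(bound_name \<theta> x P := n)) ((\<theta>(x := Var (bound_name \<theta> x P))) y) =
    ((\<lambda>y. eval S \<sigma> (\<theta> y))(x := n)) y"
  proof (cases "y = x")
    case False
    then show ?thesis
      using bound_name_fresh[OF y False, of \<theta>] by (auto intro!: eval_cong)
  qed simp
qed

lemma sat_assn_subst: "sat S \<sigma> (assn_subst \<theta> P) = sat S (\<lambda>x. eval S \<sigma> (\<theta> x)) P"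
proof (induction P arbitrary: \<sigma> \<theta>)
  case (Cond B)
  show ?case
    by (simp add: holds_subst)
next
  case (All x P)
  show ?case
    by (simp only: assn_subst.simps sat.simps Let_def All.IH sat_rename_bound)
next
  case (Ex x P)
  show ?case
    by (simp only: assn_subst.simps sat.simps Let_def Ex.IH sat_rename_bound)
qed auto

lemma sat_subst: "sat S \<sigma> (subst P x E) = sat S (\<sigma>(x := eval S \<sigma> E)) P"
proof -
  have "(\<lambda>y. eval S \<sigma> ((Var(x := E)) y)) = \<sigma>(x := eval S \<sigma> E)"
    by auto
  then show ?thesis
    by (simp only: subst_def sat_assn_subst)
qed

lemma wf_exp_subst: "wf_exp S E \<Longrightarrow> (\<And>x. wf_exp S (\<theta> x)) \<Longrightarrow> wf_exp S (exp_subst \<theta> E)"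
  by (induction E) auto

lemma wf_bexp_subst: "wf_bexp S B \<Longrightarrow> (\<And>x. wf_exp S (\<theta> x)) \<Longrightarrow> wf_bexp S (bexp_subst \<theta> B)"
  by (induction B) (auto simp: wf_exp_subst)

lemma wf_assn_subst: "wf_assn S P \<Longrightarrow> (\<And>x. wf_exp S (\<theta> x)) \<Longrightarrow> wf_assn S (assn_subst \<theta> P)"
  by (induction P arbitrary: \<theta>) (auto simp: wf_bexp_subst Let_def)

lemma wf_subst: "wf_assn S P \<Longrightarrow> wf_exp S E \<Longrightarrow> wf_assn S (subst P x E)"
  by (simp add: subst_def wf_assn_subst)


section \<open>Terminating runs\<close>

text \<open>Since \<open>step_seq\<close> can split a program in many ways, \<open>step\<close> is
  awkward to invert. Here only the head command acts and the tail is set aside, so every step can be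
  read off the first command.\<close>

fun cmd_step ::
    "('f, 'q) signature \<Rightarrow> ('v, 'f, 'q) cmd \<Rightarrow> 'v state \<Rightarrow> (('v, 'f, 'q) prog \<times> 'v state) set" where
  "cmd_step S (Asg x E) \<sigma> = {([], \<sigma>(x := eval S \<sigma> E))}"
| "cmd_step S (While B C) \<sigma> = {(if holds S \<sigma> B then C @ [While B C] else [], \<sigma>)}"
| "cmd_step S (Choice C0 C1) \<sigma> = {(C0, \<sigma>), (C1, \<sigma>)}"

lemma step_imp_cmd_step:
  assumes "step S (C, \<sigma>) (C', \<tau>)"
  shows "\<exists>c Cs D. C = c # Cs \<and> C' = D @ Cs \<and> (D, \<tau>) \<in> cmd_step S c \<sigma>"
  using assms
proof (induction "(C, \<sigma>)" "(C', \<tau>)" arbitrary: C \<sigma> C' \<tau> rule: step.induct)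
  case (step_seq C0 \<sigma> C0' \<tau> C1)
  then obtain c Cs D where "C0 = c # Cs" "C0' = D @ Cs" "(D, \<tau>) \<in> cmd_step S c \<sigma>"
    by blast
  then show ?case
    by simp
qed auto

lemma not_step_Nil: "\<not> step S ([], \<sigma>) s"
  using step_imp_cmd_step by (cases s) fastforce

lemma cmd_step_imp_step:
  assumes "(D, \<tau>) \<in> cmd_step S c \<sigma>"
  shows "step S (c # Cs, \<sigma>) (D @ Cs, \<tau>)"
proof -
  have "step S ([c], \<sigma>) (D, \<tau>)"
    using assms by (cases c) (auto intro: step_assign step_while_true step_while_false step_choice0 step_choice1 split: if_splits)
  from step_seq[OF this] show ?thesis
    by simp
qed

text \<open>The number of steps is recorded because it is the measure for loop inductions and for
  the soundness of CPRHL.\<close>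

definition run ::
    "('f, 'q) signature \<Rightarrow> nat \<Rightarrow> ('v, 'f, 'q) prog \<Rightarrow> 'v state \<Rightarrow> 'v state \<Rightarrow> bool" where
  "run S n C \<sigma> \<tau> \<longleftrightarrow> (step S ^^ n) (C, \<sigma>) ([], \<tau>)"

lemma run_Nil [simp]: "run S n [] \<sigma> \<tau> \<longleftrightarrow> n = 0 \<and> \<sigma> = \<tau>"
proof (cases n)
  case (Suc m)
  then show ?thesis
    using not_step_Nil relpowp_Suc_D2[of m "step S" "([], \<sigma>)" "([], \<tau>)"]
    by (auto simp: run_def simp del: relpowp.simps(2))
qed (simp add: run_def)

lemma run_Cons:
  "run S n (c # Cs) \<sigma> \<tau> \<longleftrightarrow>
     (\<exists>m D \<rho>. n = Suc m \<and> (D, \<rho>) \<in> cmd_step S c \<sigma> \<and> run S m (D @ Cs) \<rho> \<tau>)"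
proof
  assume *: "run S n (c # Cs) \<sigma> \<tau>"
  then obtain m where m: "n = Suc m"
    by (cases n) (auto simp: run_def)
  with * obtain C' \<rho> where "step S (c # Cs, \<sigma>) (C', \<rho>)" and run: "run S m C' \<rho> \<tau>"
    unfolding run_def by (metis relpowp_Suc_D2 surj_pair)
  from step_imp_cmd_step[OF this(1)] obtain D where "C' = D @ Cs" "(D, \<rho>) \<in> cmd_step S c \<sigma>"
    by auto
  with m run show "\<exists>m D \<rho>. n = Suc m \<and> (D, \<rho>) \<in> cmd_step S c \<sigma> \<and> run S m (D @ Cs) \<rho> \<tau>"
    by blast
next
  assume "\<exists>m D \<rho>. n = Suc m \<and> (D, \<rho>) \<in> cmd_step S c \<sigma> \<and> run S m (D @ Cs) \<rho> \<tau>"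
  then show "run S n (c # Cs) \<sigma> \<tau>"
    unfolding run_def by (metis cmd_step_imp_step relpowp_Suc_I2)
qed

lemma run_append:
  "run S n (C @ C') \<sigma> \<tau> \<longleftrightarrow> (\<exists>k m \<rho>. n = k + m \<and> run S k C \<sigma> \<rho> \<and> run S m C' \<rho> \<tau>)"
proof (induction n arbitrary: C \<sigma>)
  case 0
  show ?case
    by (cases C) (auto simp: run_Cons)
next
  case (Suc n)
  show ?case
  proof (cases C)
    case (Cons c Cs)
    have "run S (Suc n) (C @ C') \<sigma> \<tau> \<longleftrightarrow>
      (\<exists>D \<rho>. (D, \<rho>) \<in> cmd_step S c \<sigma> \<and> run S n ((D @ Cs) @ C') \<rho> \<tau>)"
      by (simp add: Cons run_Cons)
    also have "\<dots> \<longleftrightarrow> (\<exists>D \<rho> k m \<rho>'. (D, \<rho>) \<in> cmd_step S c \<sigma> \<and> n = k + m \<and>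
        run S k (D @ Cs) \<rho> \<rho>' \<and> run S m C' \<rho>' \<tau>)"
      by (subst Suc.IH) blast
    also have "\<dots> \<longleftrightarrow> (\<exists>k m \<rho>'. Suc n = k + m \<and> run S k C \<sigma> \<rho>' \<and> run S m C' \<rho>' \<tau>)"
      \<comment> \<open>The step taken by \<open>c\<close> is counted in the share of
        \<open>C\<close>, hence the witness \<open>Suc _\<close>.\<close>
      unfolding Cons run_Cons by (fastforce intro: exI[of _ "Suc _"])
    finally show ?thesis .
  qed auto
qed

lemma terminates_in_run: "terminates_in S C \<sigma> \<tau> \<longleftrightarrow> (\<exists>n. run S n C \<sigma> \<tau>)"
  by (simp add: terminates_in_def run_def rtranclp_power)

lemma terminates_in_Nil [simp]: "terminates_in S [] \<sigma> \<tau> \<longleftrightarrow> \<sigma> = \<tau>"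
  by (simp add: terminates_in_run)

lemma terminates_in_Cons:
  "terminates_in S (c # Cs) \<sigma> \<tau> \<longleftrightarrow>
     (\<exists>D \<rho>. (D, \<rho>) \<in> cmd_step S c \<sigma> \<and> terminates_in S (D @ Cs) \<rho> \<tau>)"
  by (auto simp: terminates_in_run run_Cons)

lemma terminates_in_append:
  "terminates_in S (C @ C') \<sigma> \<tau> \<longleftrightarrow>
     (\<exists>\<rho>. terminates_in S C \<sigma> \<rho> \<and> terminates_in S C' \<rho> \<tau>)"
  by (auto simp: terminates_in_run run_append)

lemma terminates_in_While:
  "terminates_in S (While B C # C') \<sigma> \<tau> \<longleftrightarrow>
     (if holds S \<sigma> B then terminates_in S (C @ While B C # C') \<sigma> \<tau>
      else terminates_in S C' \<sigma> \<tau>)"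
  by (simp add: terminates_in_Cons[of _ "While B C"])

text \<open>Reverse triples carry a property from the final state back to the initial one, so
  \<open>I\<close> travels backwards over each iteration. The rest of the loop run is shorter by the
  steps of the body plus one, hence strong induction. The last premise may assume that
  \<open>B\<close> fails because the loop has been left.\<close>

lemma run_While_invariant:
  assumes "run S n [While B C] \<sigma> \<tau>"
    and "\<And>\<rho> \<rho>'. holds S \<rho> B \<Longrightarrow> terminates_in S C \<rho> \<rho>' \<Longrightarrow> I \<rho>' \<Longrightarrow> I \<rho>"
    and "\<not> holds S \<tau> B \<Longrightarrow> I \<tau>"
  shows "I \<sigma>"
  using assms(1)
proof (induction n arbitrary: \<sigma> rule: less_induct)
  case (less n)
  show ?case
  proof (cases "holds S \<sigma> B")
    case True
    with less.prems obtain k m \<rho> where "n = Suc (k + m)" "run S k C \<sigma> \<rho>" "run S m [While B C] \<rho> \<tau>"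
      by (auto simp: run_Cons[of _ _ "While B C" "[]" \<sigma>] run_append)
    then show ?thesis
      using True assms(2) less.IH[of m \<rho>] by (auto simp: terminates_in_run)
  next
    case False
    with less.prems show ?thesis
      using assms(3) by (auto simp: run_Cons)
  qed
qed


section \<open>PRHL\<close>

lemma prhl_sound: "prhl S t \<Longrightarrow> valid S t"
proof (induction rule: prhl.induct)
  case (prhl_assign Q E x)
  show ?case
    by (auto simp: sat_subst terminates_in_Cons)
next
  case (prhl_seq P C0 R C1 Q)
  then show ?case
    by (auto simp: terminates_in_append)
next
  case (prhl_cons P C Q P' Q')
  then show ?case
    by (auto simp: entails_def)
next
  case (prhl_or P C0 Q C1)
  then show ?case
    by (auto simp: terminates_in_Cons)
next
  case (prhl_while B P C)
  \<comment> \<open>The guard fails in the final state, so there the postcondition reduces to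
    \<open>P\<close>, which serves as the invariant.\<close>
  have "sat S \<sigma> P" if "sat S \<tau> (Imp (Cond (BNot B)) P)" "run S n [While B C] \<sigma> \<tau>" for n \<sigma> \<tau>
    by (rule run_While_invariant[where I = "\<lambda>\<sigma>. sat S \<sigma> P", OF that(2)])
      (use prhl_while.IH that(1) in auto)
  then show ?case
    unfolding valid.simps terminates_in_run by blast
qed auto

section \<open>Completeness of PRHL through weakest preconditions\<close>

lemma wf_prog_Nil [simp]: "wf_prog S []"
  by (simp add: wf_prog_def)

lemma wf_prog_Cons [simp]: "wf_prog S (c # C) \<longleftrightarrow> wf_cmd S c \<and> wf_prog S C"
  by (simp add: wf_prog_def)

lemma wf_prog_append [simp]: "wf_prog S (C @ C') \<longleftrightarrow> wf_prog S C \<and> wf_prog S C'"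
  by (auto simp: wf_prog_def)

text \<open>Stated with \<open>wf_prog\<close> so that simplification keeps bodies whole; the
  defining equations, which quantify over members, are removed from the simp set below.\<close>

lemma wf_cmd_While [simp]: "wf_cmd S (While B C) \<longleftrightarrow> wf_bexp S B \<and> wf_prog S C"
  by (simp add: wf_prog_def)

lemma wf_cmd_Choice [simp]: "wf_cmd S (Choice C C') \<longleftrightarrow> wf_prog S C \<and> wf_prog S C'"
  by (simp add: wf_prog_def)

declare wf_cmd.simps(2,3) [simp del]

text \<open>The preimage of \<open>Q\<close> under the input-output relation of \<open>C\<close>; a
  triple is valid iff this assertion entails its precondition. Being a function of \<open>Q\<close>
  and \<open>C\<close>, it gives equal programs literally equal formulas, which back-links
  require.\<close>

definition weakest_pre ::
    "('f, 'q) signature \<Rightarrow> ('v, 'f, 'q) assn \<Rightarrow> ('v, 'f, 'q) prog \<Rightarrow> ('v, 'f, 'q) assn" where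
  "weakest_pre S Q C = (SOME P. wf_assn S P \<and>
     (\<forall>\<sigma>. sat S \<sigma> P \<longleftrightarrow> (\<exists>\<tau>. terminates_in S C \<sigma> \<tau> \<and> sat S \<tau> Q)))"

context
  fixes S :: "('f, 'q) signature"
  assumes expressive: "wpr_expressive TYPE('v::infinite) S"
begin

lemma weakest_pre:
  fixes Q :: "('v, 'f, 'q) assn"
  assumes "wf_assn S Q" "wf_prog S C"
  shows "wf_assn S (weakest_pre S Q C)"
    and "sat S \<sigma> (weakest_pre S Q C) \<longleftrightarrow> (\<exists>\<tau>. terminates_in S C \<sigma> \<tau> \<and> sat S \<tau> Q)"
proof -
  have "\<exists>P. wf_assn S P \<and> (\<forall>\<sigma>. sat S \<sigma> P \<longleftrightarrow> (\<exists>\<tau>. terminates_in S C \<sigma> \<tau> \<and> sat S \<tau> Q))"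
    using expressive assms unfolding wpr_expressive_def by blast
  from someI_ex[OF this, folded weakest_pre_def]
  show "wf_assn S (weakest_pre S Q C)"
    and "sat S \<sigma> (weakest_pre S Q C) \<longleftrightarrow> (\<exists>\<tau>. terminates_in S C \<sigma> \<tau> \<and> sat S \<tau> Q)"
    by blast+
qed

text \<open>Completeness for single commands is a hypothesis because bodies are lists nested inside
  commands: below, the induction hypotheses discharge it. A program is cut after its first command,
  with the weakest precondition of the rest as intermediate assertion.\<close>

lemma prhl_complete_prog:
  fixes P Q :: "('v, 'f, 'q) assn"
  assumes "\<And>c (P :: ('v, 'f, 'q) assn) Q. c \<in> set C \<Longrightarrow>
      wf_triple S (P, [c], Q) \<Longrightarrow> valid S (P, [c], Q) \<Longrightarrow> prhl S (P, [c], Q)"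
    and "wf_triple S (P, C, Q)" "valid S (P, C, Q)"
  shows "prhl S (P, C, Q)"
  using assms
proof (induction C arbitrary: P)
  case Nil
  then show ?case
    by (auto simp: entails_def intro: prhl_cons[OF prhl_axiom[of S Q]])
next
  case (Cons c C)
  let ?R = "weakest_pre S Q C"
  have wf: "wf_assn S P" "wf_cmd S c" "wf_prog S C" "wf_assn S Q"
    using Cons.prems by auto
  note R = weakest_pre[OF wf(4,3)]
  have "valid S (P, [c] @ C, Q)"
    using Cons.prems(3) by simp
  then have "valid S (P, [c], ?R)"
    unfolding valid.simps terminates_in_append R by blast
  then have 1: "prhl S (P, [c], ?R)"
    using wf R by (intro Cons.prems(1)) auto
  have "prhl S (?R, C, Q)"
    using wf R by (intro Cons.IH Cons.prems(1)) auto
  from prhl_seq[OF 1 this] show ?case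
    by simp
qed

lemma prhl_complete_cmd:
  fixes P Q :: "('v, 'f, 'q) assn"
  assumes "wf_triple S (P, [c], Q)" "valid S (P, [c], Q)"
  shows "prhl S (P, [c], Q)"
  using assms
proof (induction c arbitrary: P Q)
  case (Asg x E)
  have "prhl S (subst Q x E, [Asg x E], Q)"
    using Asg.prems by (intro prhl_assign) auto
  then show ?case
    by (rule prhl_cons) (use Asg.prems in \<open>auto simp: entails_def sat_subst terminates_in_Cons\<close>)
next
  case (While B C)
  let ?W = "weakest_pre S Q [While B C]"
  have wf: "wf_assn S P" "wf_prog S [While B C]" "wf_assn S Q" "wf_bexp S B" "wf_prog S C"
    using While.prems(1) by auto
  note W = weakest_pre[OF wf(3,2)]
  \<comment> \<open>\<open>?W\<close> is the invariant: an execution of the body followed by a loop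
    run into \<open>Q\<close> is, where \<open>B\<close> holds, again a loop run into
    \<open>Q\<close>.\<close>
  have valid: "valid S (Imp (Cond B) ?W, C, ?W)"
    unfolding valid.simps
  proof (intro allI impI)
    fix \<sigma> \<rho>
    assume "sat S \<rho> ?W" "terminates_in S C \<sigma> \<rho>"
    then obtain \<tau> where "terminates_in S (C @ [While B C]) \<sigma> \<tau>" "sat S \<tau> Q"
      using W(2) terminates_in_append by blast
    then show "sat S \<sigma> (Imp (Cond B) ?W)"
      using W(2) terminates_in_While[of S B C "[]" \<sigma> \<tau>] by auto
  qed
  have "prhl S (Imp (Cond B) ?W, C, ?W)"
    by (rule prhl_complete_prog[OF While.IH _ valid]) (use wf W(1) in simp_all)
  then have "prhl S (?W, [While B C], Imp (Cond (BNot B)) ?W)"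
    by (rule prhl_while)
  then show ?case
  proof (rule prhl_cons)
    show "entails S ?W P"
      using While.prems(2) by (auto simp: entails_def W)
    \<comment> \<open>In a state of \<open>Q\<close> falsifying \<open>B\<close> the loop stops at
      once without changing the state, so \<open>?W\<close> holds there.\<close>
    show "entails S Q (Imp (Cond (BNot B)) ?W)"
      by (auto simp: entails_def W terminates_in_Cons)
  qed (use wf in auto)
next
  case (Choice C0 C1)
  have "prhl S (P, C0, Q)"
    by (rule prhl_complete_prog[OF Choice.IH(1)]) (use Choice.prems in \<open>auto simp: terminates_in_Cons\<close>)
  moreover have "prhl S (P, C1, Q)"
    by (rule prhl_complete_prog[OF Choice.IH(2)]) (use Choice.prems in \<open>auto simp: terminates_in_Cons\<close>)
  ultimately show ?case
    by (rule prhl_or)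
qed

lemma prhl_complete:
  fixes P Q :: "('v, 'f, 'q) assn"
  assumes "wf_triple S (P, C, Q)" "valid S (P, C, Q)"
  shows "prhl S (P, C, Q)"
  by (rule prhl_complete_prog[OF prhl_complete_cmd assms])

end


section \<open>Soundness of CPRHL\<close>

lemma subtree_append:
  "subtree D (p @ q) = (case subtree D p of None \<Rightarrow> None | Some D' \<Rightarrow> subtree D' q)"
  by (induction D p rule: subtree.induct) auto

lemma derivation_subtree: "derivation S D \<Longrightarrow> subtree D p = Some D' \<Longrightarrow> derivation S D'"
  by (induction D p rule: subtree.induct) (auto split: if_splits)

definition progress :: "('v, 'f, 'q) dtree \<Rightarrow> pos \<Rightarrow> bool" where
  "progress D p \<longleftrightarrow> (\<exists>r t Ds. subtree D p = Some (Inner r t Ds) \<and> r \<noteq> ConsR)"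

text \<open>A counterexample to validity with its data exposed: \<open>\<tau>\<close> will stay
  fixed along a path, while \<open>n\<close> and \<open>\<sigma>\<close> vary.\<close>

definition refutes ::
    "('f, 'q) signature \<Rightarrow> ('v, 'f, 'q) triple \<Rightarrow> 'v state \<Rightarrow> nat \<Rightarrow> 'v state \<Rightarrow> bool" where
  "refutes S t \<tau> n \<sigma> \<longleftrightarrow>
     (case t of (P, C, Q) \<Rightarrow> run S n C \<sigma> \<tau> \<and> \<not> sat S \<sigma> P \<and> sat S \<tau> Q)"

lemma not_valid_refutes: "\<not> valid S t \<Longrightarrow> \<exists>\<tau> n \<sigma>. refutes S t \<tau> n \<sigma>"
  by (cases t) (auto simp: refutes_def terminates_in_run)

text \<open>Cons keeps the run, and its entailments turn a refutation of the conclusion into one of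
  the premise. Each other rule mirrors one execution step of the head command, so dropping the first
  step leaves a run for the premise of the branch taken.\<close>

lemma cprhl_rule_refutes:
  assumes "cprhl_rule S r ts t" "refutes S t \<tau> n \<sigma>"
  shows "\<exists>i m \<rho>. i < length ts \<and> refutes S (ts ! i) \<tau> m \<rho> \<and> m \<le> n \<and> (r \<noteq> ConsR \<longrightarrow> m < n)"
  using assms
proof (induction rule: cprhl_rule.induct)
  case (1 P' P Q Q' C)
  then have "refutes S (P', C, Q') \<tau> n \<sigma>"
    by (auto simp: refutes_def entails_def)
  then show ?case
    by - (rule exI[of _ 0], auto)
next
  case (2 P C Q x E)
  then obtain m where "n = Suc m" "refutes S (P, C, Q) \<tau> m (\<sigma>(x := eval S \<sigma> E))"
    by (auto simp: refutes_def sat_subst run_Cons)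
  then show ?case
    by - (rule exI[of _ 0], auto)
next
  case (3 P C0 C Q C1)
  then obtain m where m: "n = Suc m"
    and "refutes S (P, C0 @ C, Q) \<tau> m \<sigma> \<or> refutes S (P, C1 @ C, Q) \<tau> m \<sigma>"
    by (auto simp: refutes_def run_Cons)
  from this(2) show ?case
  proof
    assume "refutes S (P, C0 @ C, Q) \<tau> m \<sigma>"
    with m show ?case
      by - (rule exI[of _ 0], auto)
  next
    assume "refutes S (P, C1 @ C, Q) \<tau> m \<sigma>"
    with m show ?case
      by - (rule exI[of _ 1], auto)
  qed
next
  case (4 B P C' Q C)
  show ?case
  proof (cases "holds S \<sigma> B")
    case True
    \<comment> \<open>As \<open>B\<close> holds and \<open>P\<close> fails in
      \<open>\<sigma>\<close>, the implication fails as well, and the unrolled program refutes the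
      second premise.\<close>
    with 4 obtain m where "n = Suc m"
      "refutes S (Imp (Cond B) P, C @ [While B C] @ C', Q) \<tau> m \<sigma>"
      by (auto simp: refutes_def run_Cons[of _ _ "While B C" C' \<sigma>])
    then show ?thesis
      by - (rule exI[of _ 1], auto)
  next
    case False
    with 4 obtain m where "n = Suc m" "refutes S (Imp (Cond (BNot B)) P, C', Q) \<tau> m \<sigma>"
      by (auto simp: refutes_def run_Cons)
    then show ?thesis
      by - (rule exI[of _ 0], auto)
  qed
qed

text \<open>A refuted leaf is no axiom, since the empty program does not change the state. It is
  therefore open, and its companion has the same triple, refuted by the same run. At an inner node
  the next node is the premise given by \<open>cprhl_rule_refutes\<close>.\<close>

lemma pre_proof_refutes:
  assumes "pre_proof S D b" "subtree D p = Some T" "refutes S (root T) \<tau> n \<sigma>"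
  shows "\<exists>q T' m \<rho>. edge D b p q \<and> subtree D q = Some T' \<and> refutes S (root T') \<tau> m \<rho> \<and>
    m \<le> n \<and> (progress D p \<longrightarrow> m < n)"
proof (cases T)
  case (Leaf t)
  have "\<not> axiom_instance t"
    using assms(3) by (auto simp: Leaf axiom_instance_def refutes_def)
  with assms(2) have "open_leaf D p"
    by (auto simp: Leaf open_leaf_def)
  moreover from this assms(1) obtain r Ds where "subtree D (b p) = Some (Inner r t Ds)"
    using assms(2) by (auto simp: pre_proof_def companion_def Leaf)
  ultimately show ?thesis
    using assms(2,3) by (intro exI[of _ "b p"]) (auto simp: edge_def progress_def Leaf)
next
  case (Inner r t Ds)
  have "derivation S T"
    using assms(1,2) derivation_subtree by (auto simp: pre_proof_def)
  then have "cprhl_rule S r (map root Ds) t"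
    by (simp add: Inner)
  with assms(3) obtain i m \<rho> where i: "i < length Ds" "refutes S (root (Ds ! i)) \<tau> m \<rho>"
    "m \<le> n" "r \<noteq> ConsR \<Longrightarrow> m < n"
    by (force simp: Inner dest!: cprhl_rule_refutes)
  moreover have "edge D b p (p @ [i])"
    using i(1) assms(2) unfolding edge_def Inner by blast
  moreover have "subtree D (p @ [i]) = Some (Ds ! i)"
    using i(1) assms(2) by (simp add: Inner subtree_append)
  moreover have "progress D p \<Longrightarrow> r \<noteq> ConsR"
    using assms(2) by (simp add: progress_def Inner)
  ultimately show ?thesis
    by blast
qed

lemma cprhl_sound:
  assumes "cprhl S t"
  shows "valid S t"
proof (rule ccontr)
  assume "\<not> valid S t"
  then obtain \<tau> n0 \<sigma>0 where init: "refutes S t \<tau> n0 \<sigma>0"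
    using not_valid_refutes by blast
  obtain D b where D: "cprhl_proof S D b" "root D = t"
    using assms by (auto simp: cprhl_def)
  \<comment> \<open>Pairs a position with the length of a refuting run; the start state is
    quantified away since only lengths are compared along the path.\<close>
  define I where "I = (\<lambda>(p, n). \<exists>T \<sigma>. subtree D p = Some T \<and> refutes S (root T) \<tau> n \<sigma>)"
  have "\<exists>f. \<forall>k. I (f k) \<and> (edge D b (fst (f k)) (fst (f (Suc k))) \<and> snd (f (Suc k)) \<le> snd (f k) \<and>
      (progress D (fst (f k)) \<longrightarrow> snd (f (Suc k)) < snd (f k)))"
  proof (rule dependent_nat_choice)
    have "I ([], n0)"
      using init D by (auto simp: I_def)
    then show "\<exists>x. I x" ..
  next
    fix x and k :: nat
    assume "I x"
    then show "\<exists>y. I y \<and> edge D b (fst x) (fst y) \<and> snd y \<le> snd x \<and>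
      (progress D (fst x) \<longrightarrow> snd y < snd x)"
      using D pre_proof_refutes[of S D b "fst x" _ \<tau> "snd x"]
      by (fastforce simp: I_def cprhl_proof_def)
  qed
  then obtain f where "\<forall>k. I (f k) \<and> (edge D b (fst (f k)) (fst (f (Suc k))) \<and>
      snd (f (Suc k)) \<le> snd (f k) \<and> (progress D (fst (f k)) \<longrightarrow> snd (f (Suc k)) < snd (f k)))" ..
  then have f: "\<And>k. edge D b (fst (f k)) (fst (f (Suc k)))"
    "\<And>k. snd (f (Suc k)) \<le> snd (f k)"
    "\<And>k. progress D (fst (f k)) \<Longrightarrow> snd (f (Suc k)) < snd (f k)"
    by blast+
  have "infinite_path D b (\<lambda>k. fst (f k))"
    using f(1) by (simp add: infinite_path_def)
  with D(1) have inf: "\<exists>\<^sub>\<infinity>k. progress D (fst (f k))"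
    by (simp add: cprhl_proof_def progress_def)
  \<comment> \<open>Lengths never increase, so progress at some \<open>j \<ge> k\<close> would push
    them below the least value, attained at \<open>k\<close>.\<close>
  obtain k where k: "\<And>j. snd (f k) \<le> snd (f j)"
    using ex_has_least_nat[of "\<lambda>_. True" _ "\<lambda>k. snd (f k)"] by blast
  obtain j where "j \<ge> k" "progress D (fst (f j))"
    using inf by (auto simp: INFM_nat_le)
  then have "snd (f (Suc j)) < snd (f k)"
    using f(3)[of j] lift_Suc_antimono_le[of "\<lambda>k. snd (f k)", OF f(2), of k j] by simp
  with k[of "Suc j"] show False
    by simp
qed


section \<open>Completeness of CPRHL\<close>

text \<open>Sets of triples suffice in place of positions: a companion need only carry the same
  triple, so back-links can be chosen once the tree is complete.\<close>

fun open_triples :: "('v, 'f, 'q) dtree \<Rightarrow> ('v, 'f, 'q) triple set" where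
  "open_triples (Leaf t) = (if axiom_instance t then {} else {t})"
| "open_triples (Inner r t Ds) = (\<Union>D\<in>set Ds. open_triples D)"

fun progress_triples :: "('v, 'f, 'q) dtree \<Rightarrow> ('v, 'f, 'q) triple set" where
  "progress_triples (Leaf t) = {}"
| "progress_triples (Inner r t Ds) =
     (if r = ConsR then {} else {t}) \<union> (\<Union>D\<in>set Ds. progress_triples D)"

lemma open_leaf_open_triples:
  "subtree D p = Some (Leaf t) \<Longrightarrow> \<not> axiom_instance t \<Longrightarrow> t \<in> open_triples D"
  by (induction D p rule: subtree.induct) (auto split: if_splits)

lemma progress_triples_subtree:
  "t \<in> progress_triples D \<Longrightarrow> \<exists>p r Ds. subtree D p = Some (Inner r t Ds) \<and> r \<noteq> ConsR"
proof (induction D)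
  case (Inner r t' Ds)
  show ?case
  proof (cases "t = t' \<and> r \<noteq> ConsR")
    case True
    then show ?thesis
      by (intro exI[of _ "[]"]) auto
  next
    case False
    with Inner.prems obtain i where "i < length Ds" "t \<in> progress_triples (Ds ! i)"
      by (auto simp: in_set_conv_nth split: if_splits)
    moreover from this obtain p r' Ds' where "subtree (Ds ! i) p = Some (Inner r' t Ds')" "r' \<noteq> ConsR"
      using Inner.IH[of "Ds ! i"] by auto
    ultimately show ?thesis
      by (intro exI[of _ "i # p"]) auto
  qed
qed simp

lemma size_child: "D \<in> set Ds \<Longrightarrow> size D < size (Inner r t Ds)"
  using size_list_estimation'[of D Ds "size D" size] by simp

text \<open>Every infinite path follows infinitely many back-links, since tree edges shrink the subtree;
  so it is enough that all back-links lead to a node with a rule other than Cons.\<close>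

lemma cprhl_if_open_triples:
  assumes "derivation S D" "open_triples D \<subseteq> progress_triples D"
  shows "cprhl S (root D)"
proof -
  have "\<exists>q. progress D q \<and> companion D p q" if "open_leaf D p" for p
  proof -
    from that obtain t where t: "subtree D p = Some (Leaf t)" "\<not> axiom_instance t"
      by (auto simp: open_leaf_def)
    with assms(2) have "t \<in> progress_triples D"
      using open_leaf_open_triples by blast
    from progress_triples_subtree[OF this] t show ?thesis
      unfolding progress_def companion_def by blast
  qed
  then obtain b where b: "\<And>p. open_leaf D p \<Longrightarrow> progress D (b p) \<and> companion D p (b p)"
    by metis
  have "\<exists>\<^sub>\<infinity>n. progress D (\<pi> n)" if "infinite_path D b \<pi>" for \<pi>
  proof (rule ccontr)
    assume "\<not> (\<exists>\<^sub>\<infinity>n. progress D (\<pi> n))"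
    then obtain N where N: "\<And>n. n \<ge> N \<Longrightarrow> \<not> progress D (\<pi> n)"
      by (auto simp: INFM_nat_le)
    define h where "h n = size (the (subtree D (\<pi> (N + n))))" for n
    have "h (Suc n) < h n" for n
    proof -
      have "edge D b (\<pi> (N + n)) (\<pi> (Suc (N + n)))"
        using that by (simp add: infinite_path_def)
      \<comment> \<open>A back-link taken here would make the node at \<open>Suc (N + n)\<close> a
        progress node, contrary to \<open>N\<close>.\<close>
      moreover have "\<not> (open_leaf D (\<pi> (N + n)) \<and> \<pi> (Suc (N + n)) = b (\<pi> (N + n)))"
        using b[of "\<pi> (N + n)"] N[of "Suc (N + n)"] by auto
      ultimately obtain r t Ds i where "subtree D (\<pi> (N + n)) = Some (Inner r t Ds)"
        "i < length Ds" "\<pi> (Suc (N + n)) = \<pi> (N + n) @ [i]"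
        unfolding edge_def by blast
      then show ?thesis
        using size_child[of "Ds ! i" Ds r t] by (simp add: h_def subtree_append)
    qed
    then show False
      using wf_no_infinite_down_chainE[OF wf_less, of h] by blast
  qed
  then have "cprhl_proof S D b"
    using assms(1) b by (simp add: cprhl_proof_def pre_proof_def progress_def)
  then show ?thesis
    unfolding cprhl_def by blast
qed

section \<open>Building derivations backwards from a fixed postcondition\<close>

context
  fixes S :: "('f, 'q) signature"
    and Q :: "('v::infinite, 'f, 'q) assn"
  assumes expressive: "wpr_expressive TYPE('v) S"
    and wf_Q: "wf_assn S Q"
begin

abbreviation wp_triple :: "('v, 'f, 'q) prog \<Rightarrow> ('v, 'f, 'q) triple" where
  "wp_triple C \<equiv> (weakest_pre S Q C, C, Q)"

lemmas wp = weakest_pre[OF expressive wf_Q]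

text \<open>Think of \<open>D'\<close> as a part of \<open>D\<close>: its progress triples stay
  available for companions, and each open triple of \<open>D\<close> is inherited from
  \<open>D'\<close> or can already be closed inside \<open>D\<close>.\<close>

definition extends :: "('v, 'f, 'q) dtree \<Rightarrow> ('v, 'f, 'q) dtree \<Rightarrow> bool" where
  "extends D D' \<longleftrightarrow> progress_triples D' \<subseteq> progress_triples D \<and>
     open_triples D \<subseteq> open_triples D' \<union> progress_triples D"

definition wp_tree :: "('v, 'f, 'q) prog \<Rightarrow> ('v, 'f, 'q) dtree \<Rightarrow> bool" where
  "wp_tree C D \<longleftrightarrow> derivation S D \<and> root D = wp_triple C"

text \<open>CPRHL rules act on the first command in front of a continuation, so all continuations
  are allowed; in particular a loop body can be put in front of the loop itself.\<close>

definition prependable :: "('v, 'f, 'q) prog \<Rightarrow> bool" where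
  "prependable C \<longleftrightarrow> (\<forall>C' D'. wf_prog S C' \<longrightarrow> wp_tree C' D' \<longrightarrow>
     (\<exists>D. wp_tree (C @ C') D \<and> extends D D'))"

lemma extends_trans: "extends D D' \<Longrightarrow> extends D' D'' \<Longrightarrow> extends D D''"
  unfolding extends_def by blast

lemma prependable_append:
  assumes "prependable C0" "prependable C1" "wf_prog S C1"
  shows "prependable (C0 @ C1)"
  unfolding prependable_def
proof (intro allI impI)
  fix C' D'
  assume *: "wf_prog S C'" "wp_tree C' D'"
  then obtain D1 where D1: "wp_tree (C1 @ C') D1" "extends D1 D'"
    using assms(2) unfolding prependable_def by blast
  moreover have "wf_prog S (C1 @ C')"
    using assms(3) * by simp
  ultimately obtain D where "wp_tree (C0 @ C1 @ C') D" "extends D D1"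
    using assms(1) unfolding prependable_def by blast
  with D1 show "\<exists>D. wp_tree ((C0 @ C1) @ C') D \<and> extends D D'"
    using extends_trans by auto
qed

text \<open>As for PRHL, the assumption on single commands is what the induction over nested
  commands supplies.\<close>

lemma prependable_prog:
  assumes "\<And>c. c \<in> set C \<Longrightarrow> wf_cmd S c \<Longrightarrow> prependable [c]" "wf_prog S C"
  shows "prependable C"
  using assms
proof (induction C)
  case Nil
  show ?case
    by (auto simp: prependable_def extends_def)
next
  case (Cons c C)
  then show ?case
    using prependable_append[of "[c]" C] by simp
qed

text \<open>Adapts a tree to the precondition a rule dictates: \<open>OrR\<close> wants the same one
  in both premises, \<open>WhileR\<close> wants implications, and the root wants
  \<open>P\<close>.\<close>

lemma derivation_Cons:
  assumes "wp_tree C D" "wf_assn S P" "wf_prog S C" "entails S (weakest_pre S Q C) P"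
  shows "derivation S (Inner ConsR (P, C, Q) [D])"
proof -
  have "cprhl_rule S ConsR [wp_triple C] (P, C, Q)"
    using assms(4) by (intro cprhl_rule.intros) (auto simp: entails_def)
  then show ?thesis
    using assms(1-3) wf_Q by (simp add: wp_tree_def)
qed

lemma prependable_Asg:
  assumes "wf_exp S E"
  shows "prependable [Asg x E]"
  unfolding prependable_def
proof (intro allI impI)
  fix C' D'
  assume C': "wf_prog S C'" and D': "wp_tree C' D'"
  let ?C = "[Asg x E] @ C'"
  have wf: "wf_prog S ?C"
    using assms C' by simp
  let ?P = "subst (weakest_pre S Q C') x E"
  \<comment> \<open>The substituted formula is equivalent, but in general not identical, to the
    weakest precondition of \<open>?C\<close>; the \<open>ConsR\<close> node restores the
    label.\<close>
  let ?D = "Inner ConsR (wp_triple ?C) [Inner AssignR (?P, ?C, Q) [D']]"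
  have "cprhl_rule S AssignR [wp_triple C'] (?P, ?C, Q)"
    by (rule cprhl_rule.intros)
  moreover have "cprhl_rule S ConsR [(?P, ?C, Q)] (wp_triple ?C)"
    by (intro cprhl_rule.intros)
      (use wf C' in \<open>auto simp: entails_def wp sat_subst terminates_in_Cons\<close>)
  ultimately have "wp_tree ?C ?D"
    using D' wf wf_Q wp(1) C' assms by (simp add: wp_tree_def wf_subst)
  moreover have "extends ?D D'"
    by (auto simp: extends_def)
  ultimately show "\<exists>D. wp_tree ?C D \<and> extends D D'"
    by blast
qed

lemma prependable_Choice:
  assumes "prependable C0" "prependable C1" "wf_prog S C0" "wf_prog S C1"
  shows "prependable [Choice C0 C1]"
  unfolding prependable_def
proof (intro allI impI)
  fix C' D'
  assume C': "wf_prog S C'" and D': "wp_tree C' D'"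
  let ?C = "[Choice C0 C1] @ C'"
  let ?P = "weakest_pre S Q ?C"
  have wf: "wf_prog S ?C" "wf_prog S (C0 @ C')" "wf_prog S (C1 @ C')"
    using assms C' by simp_all
  obtain D0 where D0: "wp_tree (C0 @ C') D0" "extends D0 D'"
    using assms(1) C' D' unfolding prependable_def by blast
  obtain D1 where D1: "wp_tree (C1 @ C') D1" "extends D1 D'"
    using assms(2) C' D' unfolding prependable_def by blast
  let ?L = "Inner ConsR (?P, C0 @ C', Q) [D0]"
  let ?R = "Inner ConsR (?P, C1 @ C', Q) [D1]"
  let ?D = "Inner OrR (wp_triple ?C) [?L, ?R]"
  \<comment> \<open>A run of either branch becomes a run of the choice by adding one initial
    step.\<close>
  have "entails S (weakest_pre S Q (C0 @ C')) ?P" "entails S (weakest_pre S Q (C1 @ C')) ?P"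
    unfolding entails_def wp(2)[OF wf(1)] wp(2)[OF wf(2)] wp(2)[OF wf(3)]
    by (auto simp: terminates_in_Cons)
  then have "derivation S ?L" "derivation S ?R"
    using derivation_Cons[OF D0(1) wp(1)[OF wf(1)] wf(2)] derivation_Cons[OF D1(1) wp(1)[OF wf(1)] wf(3)]
    by blast+
  moreover have "cprhl_rule S OrR [(?P, C0 @ C', Q), (?P, C1 @ C', Q)] (wp_triple ?C)"
    by (rule cprhl_rule.intros)
  ultimately have "wp_tree ?C ?D"
    using wf(1) wp(1) wf_Q by (simp add: wp_tree_def del: append_Cons append_Nil)
  moreover have "extends ?D D'"
    using D0(2) D1(2) by (auto simp: extends_def)
  ultimately show "\<exists>D. wp_tree ?C D \<and> extends D D'"
    by blast
qed

text \<open>The body is prepended to a leaf labelled with the conclusion itself; its companion is the root.\<close>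

lemma prependable_While:
  assumes "prependable C" "wf_prog S C" "wf_bexp S B"
  shows "prependable [While B C]"
  unfolding prependable_def
proof (intro allI impI)
  fix C' D'
  assume C': "wf_prog S C'" and D': "wp_tree C' D'"
  let ?C = "[While B C] @ C'"
  let ?P = "weakest_pre S Q ?C"
  have wf: "wf_prog S ?C" "wf_prog S (C @ ?C)"
    using assms C' by simp_all
  have "wp_tree ?C (Leaf (wp_triple ?C))"
    using wf(1) wp(1) wf_Q by (simp add: wp_tree_def del: append_Cons append_Nil)
  with wf obtain D1 where D1: "wp_tree (C @ ?C) D1" "extends D1 (Leaf (wp_triple ?C))"
    using assms(1) unfolding prependable_def by blast
  let ?L = "Inner ConsR (Imp (Cond (BNot B)) ?P, C', Q) [D']"
  let ?R = "Inner ConsR (Imp (Cond B) ?P, C @ ?C, Q) [D1]"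
  let ?D = "Inner WhileR (wp_triple ?C) [?L, ?R]"
  have unfold: "terminates_in S ?C \<sigma> \<tau> \<longleftrightarrow>
      (if holds S \<sigma> B then terminates_in S (C @ ?C) \<sigma> \<tau> else terminates_in S C' \<sigma> \<tau>)" for \<sigma> \<tau>
    using terminates_in_While[of S B C C'] by simp
  \<comment> \<open>Each implication matters only where its condition on \<open>B\<close> holds, and
    there \<open>unfold\<close> equates runs of \<open>?C\<close> with runs of the premise's
    program.\<close>
  have "entails S (weakest_pre S Q C') (Imp (Cond (BNot B)) ?P)"
    "entails S (weakest_pre S Q (C @ ?C)) (Imp (Cond B) ?P)"
    unfolding entails_def sat.simps holds.simps wp(2)[OF wf(1)] wp(2)[OF wf(2)] wp(2)[OF C']
    using unfold by auto
  moreover have "wf_assn S (Imp (Cond (BNot B)) ?P)" "wf_assn S (Imp (Cond B) ?P)"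
    using wp(1)[OF wf(1)] assms(3) by simp_all
  ultimately have "derivation S ?L" "derivation S ?R"
    using derivation_Cons[OF D' _ C'] derivation_Cons[OF D1(1) _ wf(2)] by blast+
  moreover have "cprhl_rule S WhileR
      [(Imp (Cond (BNot B)) ?P, C', Q), (Imp (Cond B) ?P, C @ ?C, Q)] (wp_triple ?C)"
    by (rule cprhl_rule.intros)
  ultimately have "wp_tree ?C ?D"
    using wf(1) wp(1) wf_Q by (simp add: wp_tree_def del: append_Cons append_Nil)
  \<comment> \<open>The triple that \<open>D1\<close> may inherit from its leaf is
    \<open>wp_triple ?C\<close>, a progress triple because the root applies \<open>WhileR\<close> to
    it.\<close>
  moreover have "extends ?D D'"
    using D1(2) by (auto simp: extends_def split: if_splits)
  ultimately show "\<exists>D. wp_tree ?C D \<and> extends D D'"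
    by blast
qed

lemma prependable_cmd: "wf_cmd S c \<Longrightarrow> prependable [c]"
proof (induction c)
  case (Asg x E)
  then show ?case
    by (simp add: prependable_Asg)
next
  case (While B C)
  have "prependable C"
    by (rule prependable_prog[OF While.IH]) (use While.prems in auto)
  then show ?case
    using While.prems by (simp add: prependable_While)
next
  case (Choice C0 C1)
  have "prependable C0"
    by (rule prependable_prog[OF Choice.IH(1)]) (use Choice.prems in auto)
  moreover have "prependable C1"
    by (rule prependable_prog[OF Choice.IH(2)]) (use Choice.prems in auto)
  ultimately show ?case
    using Choice.prems by (simp add: prependable_Choice)
qed

lemma cprhl_complete:
  assumes "wf_triple S (P, C, Q)" "valid S (P, C, Q)"
  shows "cprhl S (P, C, Q)"
proof -
  have wf: "wf_assn S P" "wf_prog S C"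
    using assms(1) by auto
  \<comment> \<open>The starting tree for the empty program: its weakest precondition is equivalent
    to \<open>Q\<close> but need not be \<open>Q\<close>, so a \<open>ConsR\<close> node sits below
    the axiom.\<close>
  let ?L = "Inner ConsR (wp_triple []) [Leaf (Q, [], Q)]"
  have "cprhl_rule S ConsR [(Q, [], Q)] (wp_triple [])"
    by (intro cprhl_rule.intros) (auto simp: entails_def wp)
  then have "wp_tree [] ?L"
    using wf_Q wp(1) by (simp add: wp_tree_def)
  moreover have "prependable C"
    using prependable_prog prependable_cmd wf(2) by blast
  ultimately obtain D where D: "wp_tree (C @ []) D" "extends D ?L"
    unfolding prependable_def by (meson wf_prog_Nil)
  let ?D = "Inner ConsR (P, C, Q) [D]"
  have "entails S (weakest_pre S Q C) P"
    using assms(2) wf by (auto simp: entails_def wp)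
  then have "derivation S ?D"
    using D(1) wf by (intro derivation_Cons) auto
  \<comment> \<open>\<open>?L\<close> has no open triples, so by \<open>extends\<close> every open
    triple of \<open>D\<close> is a progress triple of \<open>D\<close>.\<close>
  moreover have "open_triples ?D \<subseteq> progress_triples ?D"
    using D(2) by (auto simp: extends_def axiom_instance_def)
  ultimately show ?thesis
    using cprhl_if_open_triples by fastforce
qed

end

theorem theorem4p5:
  fixes S :: "('f, 'q) signature"
    and P Q :: "('v::infinite, 'f, 'q) assn"
    and C :: "('v, 'f, 'q) prog"
  assumes "wpr_expressive TYPE('v) S"
    and "wf_triple S (P, C, Q)"
  shows "(valid S (P, C, Q) \<longleftrightarrow> prhl S (P, C, Q)) \<and>
         (prhl S (P, C, Q) \<longleftrightarrow> cprhl S (P, C, Q))"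
proof -
  have "wf_assn S Q"
    using assms(2) by simp
  then have "valid S (P, C, Q) \<Longrightarrow> cprhl S (P, C, Q)"
    using cprhl_complete assms by blast
  moreover have "valid S (P, C, Q) \<Longrightarrow> prhl S (P, C, Q)"
    using prhl_complete assms by blast
  ultimately show ?thesis
    using prhl_sound cprhl_sound by blast
qed

end
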